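(* Let $(X,d)$ be a nonempty compact metric space and let $(f^t)_{t\ge0}$ be a continuous semiflow on $X$ that is not minimal and has the gluing orbit property. Then $(X,f)$ has positive topological entropy.
   Context: A semiflow $(f^t)_{t\ge0}$ on $X$ is a continuous map $[0,\infty)\times X\to X$, $(t,x)\mapsto f^t(x)$, with $f^0=\mathrm{id}$ and $f^{s+t}=f^s\circ f^t$. It is minimal if for every $x\in X$ the orbit $\{f^t(x):t\ge0\}$ is dense in $X$. Gluing orbit property for semiflows: for every $\varepsilon>0$ there is $M(\varepsilon)>0$ such that for any orbit sequence $\mathscr{C}=\{(x_j,m_j)\in X\times[0,\infty):j=1,\dots,k\}$ there is a gap $\mathscr{G}=\{t_j\in[0,\infty):j=1,\dots,k-1\}$ with $\max\mathscr{G}\le M(\varepsilon)$ and a point $z\in X$ such that for every $j=1,\dots,k$, $d(f^{s_j+t}(z),f^t(x_j))<\varepsilon$ for every $t\in[0,m_j]$, where $s_1=0$ and $s_j=\sum_{i=1}^{j-1}(m_i+t_i)$ for $j=2,\dots,k$. Topological entropy of the semiflow: $h(f)=\lim_{\varepsilon\to0}\limsup_{T\to\infty}\frac1T\ln s(T,\varepsilon)$, where $s(T,\varepsilon)$ is the maximal cardinality of a set $E\subset X$ such that any distinct $x,y\in E$ satisfy $d(f^t(x),f^t(y))>\varepsilon$ for some $t\in[0,T]$. *)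

theory Defs
  imports "HOL-Analysis.Analysis"
begin

text \<open>A space is a subset \<open>X\<close> of a metric type. A semiflow is written \<open>f t x\<close>; only the values for
  \<open>t \<ge> 0\<close> and \<open>x \<in> X\<close> matter.\<close>

definition semiflow_on :: "'a::metric_space set \<Rightarrow> (real \<Rightarrow> 'a \<Rightarrow> 'a) \<Rightarrow> bool" where
  "semiflow_on X f \<longleftrightarrow>
     (\<forall>t\<ge>0. \<forall>x\<in>X. f t x \<in> X) \<and>
     continuous_on ({0..} \<times> X) (\<lambda>(t, x). f t x) \<and>
     (\<forall>x\<in>X. f 0 x = x) \<and>
     (\<forall>s\<ge>0. \<forall>t\<ge>0. \<forall>x\<in>X. f (s + t) x = f s (f t x))"

definition minimal_semiflow_on :: "'a::metric_space set \<Rightarrow> (real \<Rightarrow> 'a \<Rightarrow> 'a) \<Rightarrow> bool" where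
  "minimal_semiflow_on X f \<longleftrightarrow> (\<forall>x\<in>X. X \<subseteq> closure {f t x | t. t \<ge> 0})"

text \<open>Orbit sequences and gaps are functions on \<open>nat\<close>, read on the indices \<open>1, \<dots>, k\<close> and
  \<open>1, \<dots>, k - 1\<close> respectively. The starting time \<open>s\<^sub>j\<close> is the sum over \<open>{1..<j}\<close>, which is
  empty for \<open>j = 1\<close>.\<close>

definition gluing_orbit_property_on :: "'a::metric_space set \<Rightarrow> (real \<Rightarrow> 'a \<Rightarrow> 'a) \<Rightarrow> bool" where
  "gluing_orbit_property_on X f \<longleftrightarrow>
     (\<forall>\<epsilon>>0. \<exists>M>0. \<forall>(k::nat)\<ge>1. \<forall>(x :: nat \<Rightarrow> 'a) (m :: nat \<Rightarrow> real).
        (\<forall>j\<in>{1..k}. x j \<in> X \<and> m j \<ge> 0) \<longrightarrow>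
        (\<exists>\<tau> :: nat \<Rightarrow> real. (\<forall>j\<in>{1..<k}. 0 \<le> \<tau> j \<and> \<tau> j \<le> M) \<and>
           (\<exists>z\<in>X. \<forall>j\<in>{1..k}. \<forall>t\<in>{0..m j}.
              dist (f ((\<Sum>i\<in>{1..<j}. m i + \<tau> i) + t) z) (f t (x j)) < \<epsilon>)))"

definition separated_on :: "(real \<Rightarrow> 'a \<Rightarrow> 'a) \<Rightarrow> real \<Rightarrow> real \<Rightarrow> 'a::metric_space set \<Rightarrow> bool" where
  "separated_on f T \<epsilon> E \<longleftrightarrow>
     (\<forall>x\<in>E. \<forall>y\<in>E. x \<noteq> y \<longrightarrow> (\<exists>t\<in>{0..T}. dist (f t x) (f t y) > \<epsilon>))"

text \<open>The maximum is meaningful for a semiflow on a compact space and \<open>\<epsilon> > 0\<close>: by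
  \<open>separated_card_bounded\<close> below, all separated sets are then finite, of bounded cardinality.\<close>

definition max_separated_card ::
    "'a::metric_space set \<Rightarrow> (real \<Rightarrow> 'a \<Rightarrow> 'a) \<Rightarrow> real \<Rightarrow> real \<Rightarrow> nat" where
  "max_separated_card X f T \<epsilon> = Max {card E | E. E \<subseteq> X \<and> separated_on f T \<epsilon> E}"

text \<open>The limit exists in the extended reals because the upper growth rate is antitone in
  \<open>\<epsilon>\<close>; see \<open>topological_entropy_tendsto\<close> below.\<close>

definition topological_entropy :: "'a::metric_space set \<Rightarrow> (real \<Rightarrow> 'a \<Rightarrow> 'a) \<Rightarrow> ereal" where
  "topological_entropy X f =
     Lim (at_right 0)
       (\<lambda>\<epsilon>. Limsup at_top (\<lambda>T. ereal (1 / T * ln (real (max_separated_card X f T \<epsilon>)))))"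

lemma separated_card_bounded:
  assumes "compact X" "semiflow_on X f" "\<epsilon> > 0"
  obtains N where "\<And>E. E \<subseteq> X \<Longrightarrow> separated_on f T \<epsilon> E \<Longrightarrow> finite E \<and> card E \<le> N"
proof -
  have "continuous_on ({0..T} \<times> X) (\<lambda>(t, x). f t x)"
    using assms(2) unfolding semiflow_on_def by (auto elim: continuous_on_subset)
  then have "uniformly_continuous_on ({0..T} \<times> X) (\<lambda>(t, x). f t x)"
    by (intro compact_uniformly_continuous compact_Times assms) auto
  then obtain \<delta> where \<delta>: "\<delta> > 0" and
    uc: "\<And>p q. p \<in> {0..T} \<times> X \<Longrightarrow> q \<in> {0..T} \<times> X \<Longrightarrow> dist q p < \<delta> \<Longrightarrow>
          dist ((\<lambda>(t, x). f t x) q) ((\<lambda>(t, x). f t x) p) < \<epsilon>"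
    using assms(3) unfolding uniformly_continuous_on_def by blast
  obtain K where K: "finite K" "X \<subseteq> (\<Union>c\<in>K. ball c (\<delta> / 2))"
  proof -
    have "X \<subseteq> (\<Union>c\<in>X. ball c (\<delta> / 2))" using \<delta> by force
    then obtain C where "C \<subseteq> X" "finite C" "X \<subseteq> (\<Union>c\<in>C. ball c (\<delta> / 2))"
      using compactE_image[OF assms(1), of X "\<lambda>c. ball c (\<delta> / 2)"] by blast
    with that show thesis by blast
  qed
  have "finite E \<and> card E \<le> card K" if E: "E \<subseteq> X" "separated_on f T \<epsilon> E" for E
  proof -
    have "\<forall>x\<in>E. \<exists>c\<in>K. dist c x < \<delta> / 2" using K(2) E(1) by fastforce
    then obtain g where g: "\<And>x. x \<in> E \<Longrightarrow> g x \<in> K \<and> dist (g x) x < \<delta> / 2" by metis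
    have "inj_on g E"
    proof (rule inj_onI, rule ccontr)
      fix x y assume xy: "x \<in> E" "y \<in> E" "g x = g y" "x \<noteq> y"
      have d: "dist x y < \<delta>"
        using g[OF xy(1)] g[OF xy(2)] xy(3) dist_triangle_half_r[of "g x" x \<delta> y] by simp
      obtain t where t: "t \<in> {0..T}" "dist (f t x) (f t y) > \<epsilon>"
        using E(2) xy unfolding separated_on_def by blast
      have "dist (f t x) (f t y) < \<epsilon>"
        using uc[of "(t, y)" "(t, x)"] t(1) E(1) xy d by (auto simp: dist_Pair_Pair)
      with t(2) show False by simp
    qed
    moreover have "g ` E \<subseteq> K" using g by auto
    ultimately show ?thesis
      using K(1) by (meson card_inj_on_le finite_imageD finite_subset)
  qed
  then show ?thesis using that by blast
qed

lemma finite_separated_cards: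
  assumes "compact X" "semiflow_on X f" "\<epsilon> > 0"
  shows "finite {card E | E. E \<subseteq> X \<and> separated_on f T \<epsilon> E}"
proof -
  obtain N where "\<And>E. E \<subseteq> X \<Longrightarrow> separated_on f T \<epsilon> E \<Longrightarrow> finite E \<and> card E \<le> N"
    using separated_card_bounded[OF assms] by blast
  then show ?thesis by (auto intro: finite_subset[of _ "{..N}"])
qed

lemma topological_entropy_tendsto:
  assumes "compact X" "X \<noteq> {}" "semiflow_on X f"
  shows "((\<lambda>\<epsilon>. Limsup at_top (\<lambda>T. ereal (1 / T * ln (real (max_separated_card X f T \<epsilon>)))))
           \<longlongrightarrow> topological_entropy X f) (at_right 0)"
proof -
  let ?g = "\<lambda>\<epsilon>. Limsup at_top (\<lambda>T. ereal (1 / T * ln (real (max_separated_card X f T \<epsilon>))))"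
  have anti: "?g b \<le> ?g a" if ab: "0 < a" "a \<le> b" for a b
  proof (rule Limsup_mono, rule eventually_at_top_linorderI[of 1])
    fix T :: real assume T: "T \<ge> 1"
    have b: "b > 0" using ab by simp
    obtain x where x: "x \<in> X" using assms(2) by blast
    have "1 = card {x} \<and> {x} \<subseteq> X \<and> separated_on f T b {x}"
      using x by (auto simp: separated_on_def)
    then have 1: "1 \<in> {card E | E. E \<subseteq> X \<and> separated_on f T b E}" by blast
    have "separated_on f T a E" if "separated_on f T b E" for E
      using that ab unfolding separated_on_def by (meson le_less_trans)
    then have sub: "{card E | E. E \<subseteq> X \<and> separated_on f T b E}
                 \<subseteq> {card E | E. E \<subseteq> X \<and> separated_on f T a E}"
      by blast
    have "max_separated_card X f T b \<le> max_separated_card X f T a"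
      unfolding max_separated_card_def
      by (rule Max_mono[OF sub]) (use 1 finite_separated_cards[OF assms(1,3) ab(1)] in auto)
    moreover have "1 \<le> max_separated_card X f T b"
      unfolding max_separated_card_def
      by (rule Max_ge[OF finite_separated_cards[OF assms(1,3) b] 1])
    ultimately show "ereal (1 / T * ln (real (max_separated_card X f T b)))
        \<le> ereal (1 / T * ln (real (max_separated_card X f T a)))"
      using T by (auto intro!: divide_right_mono)
  qed
  have "(?g \<longlongrightarrow> (SUP \<epsilon>\<in>{0<..}. ?g \<epsilon>)) (at_right 0)"
  proof (rule order_tendstoI)
    fix l assume "l < (SUP \<epsilon>\<in>{0<..}. ?g \<epsilon>)"
    then obtain b where b: "b > 0" "l < ?g b" unfolding less_SUP_iff by blast
    have "l < ?g y" if "0 < y" "y < b" for y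
      using b(2) anti[of y b] that by (meson less_imp_le less_le_trans)
    then show "\<forall>\<^sub>F \<epsilon> in at_right 0. l < ?g \<epsilon>"
      unfolding eventually_at_right_field using b(1) by blast
  next
    fix u assume u: "(SUP \<epsilon>\<in>{0<..}. ?g \<epsilon>) < u"
    have "?g \<epsilon> < u" if "\<epsilon> > 0" for \<epsilon>
      using u that by (meson SUP_upper greaterThan_iff le_less_trans)
    then show "\<forall>\<^sub>F \<epsilon> in at_right 0. ?g \<epsilon> < u"
      unfolding eventually_at_right_field using zero_less_one by blast
  qed
  then show ?thesis
    unfolding topological_entropy_def
    by (simp only: tendsto_Lim[OF trivial_limit_at_right_real])
qed

end

theory Submission
  imports Defs
begin

text \<open>Since the semiflow is not minimal, some orbit, that of \<open>a\<close>, keeps a distance \<open>\<ge> 3\<epsilon>\<close> from some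
  point \<open>b\<close> of the space. Visits to \<open>b\<close> therefore serve as markers: an orbit that is \<open>\<epsilon>\<close>-close to
  the orbit of \<open>a\<close> cannot at the same moment be \<open>2\<epsilon>\<close>-close to \<open>b\<close>. Let \<open>M\<close> be the gap bound at scale
  \<open>\<epsilon>\<close>. A subset \<open>w\<close> of \<open>{..<n}\<close> is encoded by gluing the point \<open>b\<close> (an orbit segment of length
  zero), the orbit of \<open>a\<close> for time \<open>\<ell>\<^sub>0\<close>, then \<open>b\<close> again, the orbit of \<open>a\<close> for time \<open>\<ell>\<^sub>1\<close>, and so
  on up to a last visit to \<open>b\<close>, where \<open>\<ell>\<^sub>i\<close> is \<open>5M\<close> if \<open>i \<in> w\<close> and \<open>2M\<close> otherwise (\<open>stretch\<close>).

  The gaps are not under control, so the visits to \<open>b\<close> drift. But if two such orbits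
  were \<open>\<epsilon>\<close>-close throughout, each visit of the first to \<open>b\<close> would have to avoid all stretches along
  \<open>a\<close> of the second, and conversely. This keeps the corresponding visits of the two orbits
  within \<open>M\<close> of each other, however many gaps have passed, and a difference of \<open>3M\<close> between
  two stretch lengths is then impossible: both orbits encode the same subset
  (\<open>same_word_if_visits_avoid_stretches\<close>). Hence the \<open>2\<^sup>n\<close> subsets give \<open>2\<^sup>n\<close> points that are
  separated at scale \<open>\<epsilon>\<close> within time \<open>7Mn\<close> (\<open>exponentially_many_separated\<close>), and the entropy is positive.\<close>

section \<open>Drift of the visits to a marker\<close>

definition stretch :: "real \<Rightarrow> nat set \<Rightarrow> nat \<Rightarrow> real" where
  "stretch M w i = (if i \<in> w then 5 * M else 2 * M)"

text \<open>\<open>v i\<close> is the time of the \<open>i\<close>-th visit to the marker, and \<open>{u i..u i + stretch M w i}\<close> the period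
  that follows it. Between a visit and a period there is a gap of unknown length up to \<open>M\<close>.\<close>

definition itinerary :: "real \<Rightarrow> nat \<Rightarrow> nat set \<Rightarrow> (nat \<Rightarrow> real) \<Rightarrow> (nat \<Rightarrow> real) \<Rightarrow> bool" where
  "itinerary M n w v u \<longleftrightarrow> v 0 = 0 \<and>
     (\<forall>i<n. u i \<in> {v i..v i + M} \<and>
        v (Suc i) \<in> {u i + stretch M w i..u i + stretch M w i + M})"

lemma itinerary_visit_bounds:
  assumes "itinerary M n w v u" "M > 0" "i \<le> n"
  shows "0 \<le> v i \<and> v i \<le> 7 * M * real i"
  using assms(3)
proof (induction i)
  case 0
  then show ?case using assms(1) by (simp add: itinerary_def)
next
  case (Suc i)
  have "v i \<le> u i" "u i \<le> v i + M"
      "u i + stretch M w i \<le> v (Suc i)" "v (Suc i) \<le> u i + stretch M w i + M"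
    using assms(1) Suc.prems by (auto simp: itinerary_def)
  moreover have "0 \<le> stretch M w i" "stretch M w i \<le> 5 * M"
    using assms(2) by (auto simp: stretch_def)
  ultimately have "v (Suc i) \<le> v i + 7 * M" "v i \<le> v (Suc i)" by linarith+
  then show ?case using Suc by (auto simp: algebra_simps)
qed

text \<open>The drift between the two orbits does not accumulate. The induction carries two facts at once:
  the words agree so far, and the current visits are at most \<open>M\<close> apart. The next visit of one orbit comes at least \<open>2M\<close> after the current one, hence
  not before the next period of the other begins; having to avoid that period, it comes
  after its end. So neither orbit can be ahead of the other by more than one gap, and the two
  periods differ in length by less than \<open>3M\<close>, so they have the same length.\<close>

lemma same_word_if_visits_avoid_stretches:
  assumes it: "itinerary M n w v u" and it': "itinerary M n w' v' u'" and "M > 0"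
    and avoid: "\<And>i. i < n \<Longrightarrow> v (Suc i) \<notin> {u' i..u' i + stretch M w' i}"
    and avoid': "\<And>i. i < n \<Longrightarrow> v' (Suc i) \<notin> {u i..u i + stretch M w i}"
    and "w \<subseteq> {..<n}" "w' \<subseteq> {..<n}"
  shows "w = w'"
proof -
  have "(\<forall>j<i. j \<in> w \<longleftrightarrow> j \<in> w') \<and> \<bar>v i - v' i\<bar> \<le> M" if "i \<le> n" for i
    using that
  proof (induction i)
    case 0
    then show ?case using it it' \<open>M > 0\<close> by (simp add: itinerary_def)
  next
    case (Suc i)
    let ?l = "stretch M w i" and ?l' = "stretch M w' i"
    have IH: "\<forall>j<i. j \<in> w \<longleftrightarrow> j \<in> w'" "\<bar>v i - v' i\<bar> \<le> M" using Suc by auto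
    have i: "i < n" using Suc.prems by simp
    have l: "?l \<ge> 2 * M" "?l' \<ge> 2 * M" using \<open>M > 0\<close> by (auto simp: stretch_def)
    have b: "v i \<le> u i" "u i \<le> v i + M" "u i + ?l \<le> v (Suc i)" "v (Suc i) \<le> u i + ?l + M"
      using it i by (auto simp: itinerary_def)
    have b': "v' i \<le> u' i" "u' i \<le> v' i + M" "u' i + ?l' \<le> v' (Suc i)"
        "v' (Suc i) \<le> u' i + ?l' + M"
      using it' i by (auto simp: itinerary_def)
    have "u' i \<le> v (Suc i)" "u i \<le> v' (Suc i)" using IH(2) b b' l by linarith+
    then have a: "u' i + ?l' < v (Suc i)" "u i + ?l < v' (Suc i)"
      using avoid[OF i] avoid'[OF i] by auto
    have "\<bar>?l - ?l'\<bar> < 3 * M" using a IH(2) b b' by linarith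
    then have "i \<in> w \<longleftrightarrow> i \<in> w'" using \<open>M > 0\<close> by (auto simp: stretch_def split: if_splits)
    with IH(1) a b b' show ?case by (auto simp: less_Suc_eq)
  qed
  from this[of n] show ?thesis using assms(6,7) by auto
qed

section \<open>Gluing the itinerary of a word\<close>

definition glues_with_gap ::
    "'a::metric_space set \<Rightarrow> (real \<Rightarrow> 'a \<Rightarrow> 'a) \<Rightarrow> real \<Rightarrow> real \<Rightarrow> bool" where
  "glues_with_gap X f \<epsilon> M \<longleftrightarrow>
     (\<forall>(k::nat)\<ge>1. \<forall>(x :: nat \<Rightarrow> 'a) (m :: nat \<Rightarrow> real).
        (\<forall>j\<in>{1..k}. x j \<in> X \<and> m j \<ge> 0) \<longrightarrow>
        (\<exists>\<tau> :: nat \<Rightarrow> real. (\<forall>j\<in>{1..<k}. 0 \<le> \<tau> j \<and> \<tau> j \<le> M) \<and>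
           (\<exists>z\<in>X. \<forall>j\<in>{1..k}. \<forall>t\<in>{0..m j}.
              dist (f ((\<Sum>i\<in>{1..<j}. m i + \<tau> i) + t) z) (f t (x j)) < \<epsilon>)))"

lemma orbit_avoids_point_if_not_minimal:
  assumes "\<not> minimal_semiflow_on X f"
  obtains a b r where "a \<in> X" "b \<in> X" "r > 0" "\<And>t. t \<ge> 0 \<Longrightarrow> dist (f t a) b \<ge> r"
proof -
  obtain a b where ab: "a \<in> X" "b \<in> X" "b \<notin> closure {f t a | t. t \<ge> 0}"
    using assms by (auto simp: minimal_semiflow_on_def)
  then obtain r where "r > 0" "\<forall>p\<in>{f t a | t. t \<ge> 0}. \<not> dist p b < r"
    by (auto simp: closure_approachable)
  with ab that show thesis by (metis (mono_tags, lifting) mem_Collect_eq not_less)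
qed

text \<open>The visits to \<open>b\<close> are orbit segments of length zero; they occupy the odd places of the
  glued orbit sequence, and the segments along \<open>a\<close> the even ones.\<close>

lemma glue_word:
  assumes sf: "semiflow_on X f" and ab: "a \<in> X" "b \<in> X" and "M > 0"
    and glue: "glues_with_gap X f \<epsilon> M"
  obtains z v u where "z \<in> X" "itinerary M n w v u"
    "\<And>i. i \<le> n \<Longrightarrow> dist (f (v i) z) b < \<epsilon>"
    "\<And>i t. i < n \<Longrightarrow> t \<in> {u i..u i + stretch M w i} \<Longrightarrow> dist (f t z) (f (t - u i) a) < \<epsilon>"
proof -
  define x where "x j = (if odd j then b else a)" for j :: nat
  \<comment> \<open>Place \<open>2i + 2\<close> holds the \<open>i\<close>-th segment along \<open>a\<close>.\<close>
  define m where "m j = (if odd j then 0 else stretch M w (j div 2 - 1))" for j :: nat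
  have segments: "x j \<in> X \<and> m j \<ge> 0" for j
    using ab \<open>M > 0\<close> by (auto simp: x_def m_def stretch_def)
  obtain \<tau> where \<tau>': "\<forall>j\<in>{1..<2 * n + 1}. 0 \<le> \<tau> j \<and> \<tau> j \<le> M"
    and "\<exists>z\<in>X. \<forall>j\<in>{1..2 * n + 1}. \<forall>t\<in>{0..m j}.
          dist (f ((\<Sum>i\<in>{1..<j}. m i + \<tau> i) + t) z) (f t (x j)) < \<epsilon>"
    using glue[unfolded glues_with_gap_def, rule_format, of "2 * n + 1" x m, OF le_add2 segments]
    by (elim exE conjE) (rule that)
  then obtain z where "z \<in> X" and z': "\<forall>j\<in>{1..2 * n + 1}. \<forall>t\<in>{0..m j}.
          dist (f ((\<Sum>i\<in>{1..<j}. m i + \<tau> i) + t) z) (f t (x j)) < \<epsilon>"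
    by (elim bexE) (rule that)
  note \<tau> = \<tau>'[rule_format] and z = z'[rule_format]
  define s where "s j = (\<Sum>i\<in>{1..<j}. m i + \<tau> i)" for j
  define v where "v i = s (2 * i + 1)" for i
  define u where "u i = s (2 * i + 2)" for i
  have s_Suc: "s (Suc j) = s j + m j + \<tau> j" if "j \<ge> 1" for j
    using that by (simp add: s_def)
  have uv: "u i = v i + \<tau> (2 * i + 1)" for i
    using s_Suc[of "2 * i + 1"] by (simp add: u_def v_def m_def)
  have vu: "v (Suc i) = u i + stretch M w i + \<tau> (2 * i + 2)" for i
    using s_Suc[of "2 * i + 2"] by (simp add: u_def v_def m_def)
  have "v 0 = 0" by (simp add: v_def s_def)
  then have "itinerary M n w v u"
    unfolding itinerary_def using uv vu \<tau> by auto
  moreover have "dist (f (v i) z) b < \<epsilon>" if "i \<le> n" for i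
    using z[of "2 * i + 1" 0] that sf ab
    by (simp add: v_def s_def m_def x_def semiflow_on_def)
  moreover have "dist (f t z) (f (t - u i) a) < \<epsilon>"
    if "i < n" "t \<in> {u i..u i + stretch M w i}" for i t
  proof -
    have "t - u i \<in> {0..m (2 * i + 2)}" using that by (auto simp: m_def)
    then show ?thesis
      using z[of "2 * i + 2" "t - u i"] that by (simp add: u_def s_def x_def)
  qed
  ultimately show thesis using that \<open>z \<in> X\<close> by blast
qed

section \<open>Exponential growth of separated sets\<close>

text \<open>The points glued for two different words cannot stay \<open>\<epsilon>\<close>-close up to time \<open>T\<close>: otherwise every
  visit of one to \<open>b\<close> avoids the periods that the other spends along the orbit of \<open>a\<close>, and
  the words coincide. A letter takes time at most \<open>7M\<close>: the longest stretch \<open>5M\<close> and two gaps.\<close>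

lemma exponentially_many_separated:
  assumes sf: "semiflow_on X f" and "\<not> minimal_semiflow_on X f"
    and gl: "gluing_orbit_property_on X f"
  obtains \<epsilon> P where "\<epsilon> > 0" "P > 0"
    "\<And>n T. T \<ge> P * real n \<Longrightarrow> \<exists>E\<subseteq>X. separated_on f T \<epsilon> E \<and> card E = 2 ^ n"
proof -
  obtain a b r where ab: "a \<in> X" "b \<in> X" and "r > 0"
    and far: "\<And>t. t \<ge> 0 \<Longrightarrow> dist (f t a) b \<ge> r"
    using orbit_avoids_point_if_not_minimal[OF assms(2)] by blast
  \<comment> \<open>Three errors add up: shadowing \<open>b\<close>, shadowing \<open>a\<close>, and the distance between two glued orbits.\<close>
  define \<epsilon> where "\<epsilon> = r / 3"
  have "\<epsilon> > 0" using \<open>r > 0\<close> by (simp add: \<epsilon>_def)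
  have "\<forall>\<epsilon>>0. \<exists>M>0. glues_with_gap X f \<epsilon> M"
    using gl unfolding gluing_orbit_property_on_def glues_with_gap_def .
  with \<open>\<epsilon> > 0\<close> obtain M where "M > 0" and glue: "glues_with_gap X f \<epsilon> M" by blast
  have "\<exists>E\<subseteq>X. separated_on f T \<epsilon> E \<and> card E = 2 ^ n" if T: "T \<ge> 7 * M * real n" for n T
  proof -
    have "\<exists>z v u. z \<in> X \<and> itinerary M n w v u \<and>
      (\<forall>i\<le>n. dist (f (v i) z) b < \<epsilon>) \<and>
      (\<forall>i<n. \<forall>t\<in>{u i..u i + stretch M w i}. dist (f t z) (f (t - u i) a) < \<epsilon>)" for w
      by (rule glue_word[OF sf ab \<open>M > 0\<close> glue, of n w]) blast
    then obtain z v u where "\<And>w. z w \<in> X" and it: "\<And>w. itinerary M n w (v w) (u w)"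
      and visit: "\<And>w i. i \<le> n \<Longrightarrow> dist (f (v w i) (z w)) b < \<epsilon>"
      and along: "\<And>w i t. i < n \<Longrightarrow> t \<in> {u w i..u w i + stretch M w i} \<Longrightarrow>
        dist (f t (z w)) (f (t - u w i) a) < \<epsilon>"
      by metis
    have sep: "\<exists>t\<in>{0..T}. dist (f t (z w)) (f t (z w')) > \<epsilon>"
      if w: "w \<subseteq> {..<n}" "w' \<subseteq> {..<n}" "w \<noteq> w'" for w w'
    proof (rule ccontr)
      assume "\<not> ?thesis"
      then have near: "dist (f t (z w)) (f t (z w')) \<le> \<epsilon>" if "t \<in> {0..T}" for t
        using that by force
      have times: "v x (Suc i) \<in> {0..T}" if "i < n" for x i
      proof -
        have "7 * M * real (Suc i) \<le> 7 * M * real n" using that \<open>M > 0\<close> by simp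
        then show ?thesis
          using itinerary_visit_bounds[OF it[of x] \<open>M > 0\<close>, of "Suc i"] that T by simp
      qed
      have avoid: "v x (Suc i) \<notin> {u y i..u y i + stretch M y i}"
        if "i < n" and xy: "{x, y} = {w, w'}" for x y i
      proof
        let ?t = "v x (Suc i)"
        assume t: "?t \<in> {u y i..u y i + stretch M y i}"
        have "dist (f ?t (z x)) (f ?t (z y)) \<le> \<epsilon>"
          using near[OF times[OF \<open>i < n\<close>]] xy by (auto simp: doubleton_eq_iff dist_commute)
        moreover have "dist (f ?t (z x)) b < \<epsilon>" using visit that by simp
        moreover have "dist (f ?t (z y)) (f (?t - u y i) a) < \<epsilon>" using along t that by blast
        ultimately have "dist (f (?t - u y i) a) b < 3 * \<epsilon>"
          using dist_triangle3[of "f (?t - u y i) a" b "f ?t (z y)"]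
            dist_triangle3[of "f ?t (z y)" b "f ?t (z x)"] by linarith
        with far[of "?t - u y i"] t show False by (simp add: \<epsilon>_def)
      qed
      have "w = w'"
        by (rule same_word_if_visits_avoid_stretches[OF it it \<open>M > 0\<close>])
          (use avoid w in \<open>auto simp del: atLeastAtMost_iff\<close>)
      with w show False by simp
    qed
    have inj: "inj_on z (Pow {..<n})"
      using sep \<open>\<epsilon> > 0\<close> by (intro inj_onI) (metis PowD dist_self less_asym)
    have "separated_on f T \<epsilon> (z ` Pow {..<n})"
      unfolding separated_on_def using sep by blast
    moreover have "card (z ` Pow {..<n}) = 2 ^ n"
      using card_image[OF inj] by (simp add: card_Pow)
    ultimately show ?thesis using \<open>\<And>w. z w \<in> X\<close> by (intro exI[of _ "z ` Pow {..<n}"]) auto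
  qed
  moreover have "7 * M > 0" using \<open>M > 0\<close> by simp
  ultimately show thesis by (intro that[OF \<open>\<epsilon> > 0\<close>])
qed

lemma card_le_max_separated_card:
  assumes "compact X" "semiflow_on X f" "\<epsilon> > 0" "E \<subseteq> X" "separated_on f T \<epsilon> E"
  shows "card E \<le> max_separated_card X f T \<epsilon>"
  unfolding max_separated_card_def
  by (rule Max_ge[OF finite_separated_cards[OF assms(1-3)]]) (use assms(4,5) in blast)

theorem proposition7p4:
  fixes X :: "'a::metric_space set" and f :: "real \<Rightarrow> 'a \<Rightarrow> 'a"
  assumes "compact X" and "X \<noteq> {}"
    and "semiflow_on X f"
    and "\<not> minimal_semiflow_on X f"
    and "gluing_orbit_property_on X f"
  shows "topological_entropy X f > 0"
proof -
  obtain \<epsilon> P where "\<epsilon> > 0" "P > 0" and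
    many: "\<And>n T. T \<ge> P * real n \<Longrightarrow> \<exists>E\<subseteq>X. separated_on f T \<epsilon> E \<and> card E = 2 ^ n"
    by (rule exponentially_many_separated[OF assms(3-5)]) (rule that)
  define c where "c = ln 2 / (2 * P)"
  have "c > 0" using \<open>P > 0\<close> by (simp add: c_def)
  have rate: "c \<le> 1 / T * ln (real (max_separated_card X f T \<delta>))"
    if \<delta>: "0 < \<delta>" "\<delta> < \<epsilon>" and T: "T \<ge> P" for \<delta> T
  proof -
    define n where "n = nat \<lfloor>T / P\<rfloor>"
    have "T / P \<ge> 1" using T \<open>P > 0\<close> by simp
    \<comment> \<open>Rounding \<open>T / P \<ge> 1\<close> down loses at most half of it, whence the factor 2 in \<open>c\<close>.\<close>
    moreover from this have "real n = of_int \<lfloor>T / P\<rfloor>" "\<lfloor>T / P\<rfloor> \<ge> 1" by (simp_all add: n_def)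
    ultimately have n: "real n \<le> T / P" "T / P \<le> 2 * real n" by linarith+
    then have "P * real n \<le> T" using \<open>P > 0\<close> by (simp add: field_simps)
    from many[OF this] obtain E where
      E: "E \<subseteq> X" "separated_on f T \<epsilon> E" "card E = 2 ^ n" by blast
    have "separated_on f T \<delta> E"
      using E(2) less_imp_le[OF \<delta>(2)] unfolding separated_on_def by (meson le_less_trans)
    then have "2 ^ n \<le> max_separated_card X f T \<delta>"
      using card_le_max_separated_card[OF assms(1,3) \<delta>(1) E(1)] E(3) by metis
    then have "real (2 ^ n) \<le> real (max_separated_card X f T \<delta>)" by (simp only: of_nat_le_iff)
    then have "ln (real (2 ^ n)) \<le> ln (real (max_separated_card X f T \<delta>))"
      by (intro ln_mono) simp_all
    then have ln_card: "real n * ln 2 \<le> ln (real (max_separated_card X f T \<delta>))"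
      by (simp add: ln_realpow)
    have "c * T = ln 2 / 2 * (T / P)" by (simp add: c_def)
    also have "\<dots> \<le> ln 2 / 2 * (2 * real n)" using n(2) by (rule mult_left_mono) simp
    also have "\<dots> = real n * ln 2" by simp
    also note ln_card
    finally have "c * T \<le> ln (real (max_separated_card X f T \<delta>))" .
    moreover have "T > 0" using T \<open>P > 0\<close> by simp
    ultimately show ?thesis by (simp add: pos_le_divide_eq)
  qed
  have "ereal c \<le> Limsup at_top (\<lambda>T. ereal (1 / T * ln (real (max_separated_card X f T \<delta>))))"
    if "0 < \<delta>" "\<delta> < \<epsilon>" for \<delta>
  proof (rule le_Limsup)
    show "\<forall>\<^sub>F T in at_top. ereal c \<le> ereal (1 / T * ln (real (max_separated_card X f T \<delta>)))"
      using eventually_ge_at_top[of P] by eventually_elim (use rate[OF that] in simp)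
  qed simp
  then have "\<forall>\<^sub>F \<delta> in at_right 0.
      ereal c \<le> Limsup at_top (\<lambda>T. ereal (1 / T * ln (real (max_separated_card X f T \<delta>))))"
    unfolding eventually_at_right_field using \<open>\<epsilon> > 0\<close> by blast
  then have "ereal c \<le> topological_entropy X f"
    by (rule tendsto_lowerbound[OF topological_entropy_tendsto[OF assms(1-3)]]) simp
  moreover have "0 < ereal c" using \<open>c > 0\<close> by simp
  ultimately show ?thesis by (rule less_le_trans[rotated])
qed

end
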